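(* Let $\varphi:\mathbb{M}(n)\to\mathbb{C}$ be a positive unital linear functional, let $A\in\mathbb{M}(n)$ be Hermitian, and put $B=A-\varphi(A)I$. Let $\mu_{\min}$ and $\mu_{\max}$ be the smallest and largest eigenvalues of $B$. Define $$\beta_1=-\varphi(B^4)\varphi(B^3)-\varphi(B^2)^2\varphi(B^3)+\varphi(B^2)\varphi(B^5),$$ $$\beta_2=-\varphi(B^3)\varphi(B^5)+\varphi(B^4)^2+\varphi(B^3)^2\varphi(B^2)-\varphi(B^2)^2\varphi(B^4),$$ $$\beta_3=2\varphi(B^2)\varphi(B^3)\varphi(B^4)-\varphi(B^2)^2\varphi(B^5)-\varphi(B^3)^3,$$ $$\gamma=\varphi(B^3)^2-\varphi(B^2)\varphi(B^4)+\varphi(B^2)^3,$$ and assume $\gamma\neq 0$. Then the cubic polynomial $$p(x)=x^3+\frac{\beta_1}{\gamma}x^2+\frac{\beta_2}{\gamma}x+\frac{\beta_3}{\gamma}$$ satisfies $p(\mu_{\max})\ge 0$ and $p(\mu_{\min})\le 0$.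
   Context: $\mathbb{M}(n)$ is the $C^*$-algebra of all $n\times n$ complex matrices. A linear functional $\varphi:\mathbb{M}(n)\to\mathbb{C}$ is positive if $\varphi(X)\ge 0$ for every positive semidefinite $X$, and unital if $\varphi(I)=1$. (For Hermitian $A$, $\varphi(A)$ is real, so $B$ is Hermitian and all the numbers $\varphi(B^s)$ are real.) *)

theory Defs
  imports "Jordan_Normal_Form.Spectral_Radius" "Jordan_Normal_Form.Schur_Decomposition"
begin

text \<open>The algebra of complex \<open>n \<times> n\<close> matrices is \<open>carrier_mat n n\<close>. The order on \<^typ>\<open>complex\<close> is the
  one of \<^theory>\<open>HOL-Library.Complex_Order\<close>: \<open>0 \<le> z\<close> means that \<open>z\<close> is real and nonnegative.\<close>

definition hermitian_mat :: "nat \<Rightarrow> complex mat \<Rightarrow> bool" where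
  "hermitian_mat n A \<longleftrightarrow> A \<in> carrier_mat n n \<and> mat_adjoint A = A"

text \<open>By the meaning of \<open>\<le>\<close> on \<^typ>\<open>complex\<close>, the quadratic form is required to be real;
  over the complex numbers this makes \<open>X\<close> Hermitian.\<close>

definition psd_mat :: "nat \<Rightarrow> complex mat \<Rightarrow> bool" where
  "psd_mat n X \<longleftrightarrow> X \<in> carrier_mat n n \<and> (\<forall>v \<in> carrier_vec n. 0 \<le> (X *\<^sub>v v) \<bullet>c v)"

text \<open>Values of \<open>\<phi>\<close> outside \<open>carrier_mat n n\<close> are irrelevant.\<close>

definition linear_functional_mat :: "nat \<Rightarrow> (complex mat \<Rightarrow> complex) \<Rightarrow> bool" where
  "linear_functional_mat n \<phi> \<longleftrightarrow>
     (\<forall>X \<in> carrier_mat n n. \<forall>Y \<in> carrier_mat n n. \<phi> (X + Y) = \<phi> X + \<phi> Y) \<and>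
     (\<forall>c. \<forall>X \<in> carrier_mat n n. \<phi> (c \<cdot>\<^sub>m X) = c * \<phi> X)"

definition positive_functional_mat :: "nat \<Rightarrow> (complex mat \<Rightarrow> complex) \<Rightarrow> bool" where
  "positive_functional_mat n \<phi> \<longleftrightarrow> (\<forall>X. psd_mat n X \<longrightarrow> 0 \<le> \<phi> X)"

definition unital_functional_mat :: "nat \<Rightarrow> (complex mat \<Rightarrow> complex) \<Rightarrow> bool" where
  "unital_functional_mat n \<phi> \<longleftrightarrow> \<phi> (1\<^sub>m n) = 1"

text \<open>The smallest and largest eigenvalue, for Hermitian matrices of positive size, all of whose
  eigenvalues are real.\<close>

definition min_eigenvalue :: "complex mat \<Rightarrow> real" where
  "min_eigenvalue A = Min {x. eigenvalue A (complex_of_real x)}"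

definition max_eigenvalue :: "complex mat \<Rightarrow> real" where
  "max_eigenvalue A = Max {x. eigenvalue A (complex_of_real x)}"

end

theory Submission
  imports Defs
begin

text \<open>Diagonalising \<open>A\<close> by a unitary turns \<open>\<phi> (B ^ k)\<close> into the \<open>k\<close>-th moment \<open>m k\<close> of a probability
  measure with weights \<open>w i\<close> at the eigenvalues \<open>x i\<close> of \<open>B\<close>, and \<open>p\<close> is the monic cubic orthogonal to
  all polynomials of degree at most two. If \<open>p (max x) < 0\<close>, then \<open>p\<close> has a root \<open>r > max x\<close>. Writing
  \<open>p = (y - r) q\<close>, orthogonality of \<open>p\<close> to \<open>q\<close> gives \<open>(\<Sum>i. w i * (r - x i) * q (x i)\<^sup>2) = 0\<close>, so \<open>q\<close>
  vanishes on the support of the measure. Then the Hankel determinant \<open>- \<gamma>\<close> of the moments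
  \<open>m 0, \<dots>, m 4\<close> vanishes too, a contradiction. The smallest eigenvalue is handled by reflection.\<close>

section \<open>Adjoints, and products that are positive semidefinite\<close>

lemma mat_adjoint_carrier [simp]:
  "A \<in> carrier_mat nr nc \<Longrightarrow> mat_adjoint A \<in> carrier_mat nc nr"
  unfolding mat_adjoint_def by (auto simp: mat_of_rows_def)

lemma mat_adjoint_index:
  assumes "A \<in> carrier_mat nr nc" "i < nc" "j < nr"
  shows "mat_adjoint A $$ (i, j) = conjugate (A $$ (j, i))"
  using assms unfolding mat_adjoint_def by (auto simp: mat_of_rows_index)

lemma dim_mat_adjoint [simp]:
  "dim_row (mat_adjoint A) = dim_col A" "dim_col (mat_adjoint A) = dim_row A"
  unfolding mat_adjoint_def by (auto simp: mat_of_rows_def)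

lemma mat_adjoint_mat_adjoint [simp]:
  fixes A :: "'a :: conjugatable_field mat"
  shows "mat_adjoint (mat_adjoint A) = A"
proof -
  have A: "A \<in> carrier_mat (dim_row A) (dim_col A)" by simp
  note A' = mat_adjoint_carrier[OF A]
  show ?thesis
    by (rule eq_matI) (auto simp: mat_adjoint_index[OF A'] mat_adjoint_index[OF A])
qed

lemma mat_adjoint_mult:
  fixes A B :: "'a :: conjugatable_field mat"
  assumes A: "A \<in> carrier_mat nr m" and B: "B \<in> carrier_mat m nc"
  shows "mat_adjoint (A * B) = mat_adjoint B * mat_adjoint A"
proof -
  have AB: "A * B \<in> carrier_mat nr nc" using A B by simp
  show ?thesis
  proof (rule eq_matI)
    fix i j assume "i < dim_row (mat_adjoint B * mat_adjoint A)"
      "j < dim_col (mat_adjoint B * mat_adjoint A)"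
    then have i: "i < nc" and j: "j < nr" using A B by auto
    have "mat_adjoint (A * B) $$ (i, j) = (\<Sum>k<m. conjugate (A $$ (j, k)) * conjugate (B $$ (k, i)))"
      using i j A B
      by (simp add: mat_adjoint_index[OF AB] scalar_prod_def sum_conjugate conjugate_dist_mul
          atLeast0LessThan)
    also have "\<dots> = (\<Sum>k<m. mat_adjoint B $$ (i, k) * mat_adjoint A $$ (k, j))"
      using i j
      by (simp add: mat_adjoint_index[OF A] mat_adjoint_index[OF B] mult.commute)
    also have "\<dots> = (mat_adjoint B * mat_adjoint A) $$ (i, j)"
      using i j A B by (simp add: scalar_prod_def atLeast0LessThan)
    finally show "mat_adjoint (A * B) $$ (i, j) = (mat_adjoint B * mat_adjoint A) $$ (i, j)" .
  qed (use A B in auto)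
qed

lemma cscalar_prod_mat_adjoint:
  fixes X :: "complex mat"
  assumes X: "X \<in> carrier_mat m n" and u: "u \<in> carrier_vec m" and v: "v \<in> carrier_vec n"
  shows "(mat_adjoint X *\<^sub>v u) \<bullet>c v = u \<bullet>c (X *\<^sub>v v)"
proof -
  have "(mat_adjoint X *\<^sub>v u) $ i = (\<Sum>j<m. cnj (X $$ (j, i)) * u $ j)" if "i < n" for i
    using that X u by (simp add: scalar_prod_def atLeast0LessThan mat_adjoint_index[OF X])
  then have "(mat_adjoint X *\<^sub>v u) \<bullet>c v = (\<Sum>i<n. \<Sum>j<m. cnj (X $$ (j, i)) * u $ j * cnj (v $ i))"
    using v by (simp add: scalar_prod_def[of _ "conjugate v"] sum_distrib_right atLeast0LessThan)
  also have "\<dots> = (\<Sum>j<m. \<Sum>i<n. cnj (X $$ (j, i)) * u $ j * cnj (v $ i))"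
    by (rule sum.swap)
  also have "\<dots> = u \<bullet>c (X *\<^sub>v v)"
    using X u v
    by (simp add: scalar_prod_def sum_distrib_left atLeast0LessThan mult_ac)
  finally show ?thesis .
qed

text \<open>The quadratic form at \<open>v\<close> is the squared norm of
  \<open>X *\<^sub>v v\<close>. This is how positivity of a functional is brought to bear later: a
  matrix is exhibited as such a product.\<close>

lemma psd_mat_adjoint_mult:
  assumes X: "X \<in> carrier_mat m n"
  shows "psd_mat n (mat_adjoint X * X)"
  unfolding psd_mat_def
proof (intro conjI ballI)
  fix v :: "complex vec" assume v: "v \<in> carrier_vec n"
  have "((mat_adjoint X * X) *\<^sub>v v) \<bullet>c v = (X *\<^sub>v v) \<bullet>c (X *\<^sub>v v)"
    using X v assoc_mult_mat_vec[OF mat_adjoint_carrier[OF X] X v]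
    by (simp add: cscalar_prod_mat_adjoint[OF X])
  then show "0 \<le> ((mat_adjoint X * X) *\<^sub>v v) \<bullet>c v"
    by (simp add: conjugate_square_ge_0_vec)
qed (use X in \<open>auto intro!: mult_carrier_mat\<close>)

section \<open>Unitary diagonalization of Hermitian matrices\<close>

lemma unitary_extending_vec:
  fixes v :: "complex vec"
  assumes v: "v \<in> carrier_vec n" and v0: "v \<noteq> 0\<^sub>v n"
  obtains W c where "W \<in> carrier_mat n n" "mat_adjoint W * W = 1\<^sub>m n" "col W 0 = c \<cdot>\<^sub>v v"
proof -
  interpret cof_vec_space n "TYPE(complex)" .
  \<comment> \<open>The completed basis starts with \<open>v\<close>, and Gram-Schmidt leaves the
    first vector unchanged, so \<open>v\<close> is still the first of the orthogonal vectors
    \<open>ws\<close>.\<close>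
  define b where "b = basis_completion v"
  define ws where "ws = gram_schmidt n b"
  note bc = basis_completion[OF v v0, folded b_def]
  have n: "n \<noteq> 0" using v v0 by auto
  then obtain vs where bv: "b = v # vs" using bc(6,7) by (cases b) auto
  note gs = gram_schmidt_result[OF bc(2,4,5) refl, folded ws_def]
  have len: "length ws = n" using gs(4) bc(6) by simp
  have "hd ws = v" unfolding ws_def bv by (rule gram_schmidt_hd[OF v])
  then have ws0: "ws ! 0 = v" using len n by (cases ws) auto
  have wsc: "ws ! j \<in> carrier_vec n" if "j < n" for j
    using gs(3) len that nth_mem by blast
  \<comment> \<open>Gram-Schmidt gives orthogonal vectors without normalizing them, so
    \<open>s j\<close> is the norm to divide by. It is real because the radicand is nonnegative in
    the order on complex numbers, and nonzero because \<open>corthogonal\<close> excludes vectors of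
    norm zero.\<close>
  define s where "s j = csqrt (ws ! j \<bullet>c ws ! j)" for j
  have sq: "s j * s j = ws ! j \<bullet>c ws ! j" for j
    unfolding s_def by (metis power2_csqrt power2_eq_square)
  have pos: "0 \<le> ws ! j \<bullet>c ws ! j" for j by (rule conjugate_square_ge_0_vec)
  have sreal: "cnj (s j) = s j" for j
    using pos[of j] unfolding s_def
    by (metis csqrt_of_real_nonneg Reals_cnj_iff less_eq_complex_def
        complex_cnj_complex_of_real zero_complex.simps)
  have s0: "s j \<noteq> 0" if "j < n" for j
    using corthogonalD[OF gs(2), of j j] that len sq[of j] by auto
  define W where "W = mat n n (\<lambda>(i, j). ws ! j $ i / s j)"
  have W: "W \<in> carrier_mat n n" by (simp add: W_def)
  have "mat_adjoint W * W = 1\<^sub>m n"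
  proof (rule eq_matI)
    fix i j assume "i < dim_row (1\<^sub>m n :: complex mat)" "j < dim_col (1\<^sub>m n :: complex mat)"
    then have i: "i < n" and j: "j < n" by auto
    have "(mat_adjoint W * W) $$ (i, j) = (\<Sum>k<n. mat_adjoint W $$ (i, k) * W $$ (k, j))"
      using i j W by (simp add: scalar_prod_def atLeast0LessThan)
    also have "\<dots> = (\<Sum>k<n. cnj (ws ! i $ k / s i) * (ws ! j $ k / s j))"
      using i j by (simp add: mat_adjoint_index[OF W]) (simp add: W_def)
    also have "\<dots> = (ws ! j \<bullet>c ws ! i) / (s i * s j)"
      using wsc[OF i] wsc[OF j]
      by (simp add: scalar_prod_def sreal sum_divide_distrib atLeast0LessThan mult_ac)
    also have "\<dots> = (if i = j then 1 else 0)"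
      using corthogonalD[OF gs(2), of j i] i j len s0[OF i] sq[of i] by auto
    finally show "(mat_adjoint W * W) $$ (i, j) = 1\<^sub>m n $$ (i, j)" using i j by simp
  qed (use W mat_adjoint_carrier[OF W] in auto)
  moreover have "col W 0 = (1 / s 0) \<cdot>\<^sub>v v"
    using n v ws0 by (auto simp: W_def)
  ultimately show ?thesis using that W by blast
qed

lemma mat_adjoint_hermitian_conj:
  fixes A :: "'a :: conjugatable_field mat"
  assumes A: "A \<in> carrier_mat n n" "mat_adjoint A = A" and W: "W \<in> carrier_mat n n"
  shows "mat_adjoint (mat_adjoint W * A * W) = mat_adjoint W * A * W"
  using A W mat_adjoint_carrier[OF W]
  by (simp add: mat_adjoint_mult[of _ n n _ n] assoc_mult_mat[of _ n n _ n _ n] mult_carrier_mat[of _ n n _ n])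

lemma unitary_conj_cancel:
  fixes A :: "'a :: conjugatable_field mat"
  assumes A: "A \<in> carrier_mat n n" and W: "W \<in> carrier_mat n n"
    and WW: "W * mat_adjoint W = 1\<^sub>m n"
  shows "A = W * (mat_adjoint W * A * W) * mat_adjoint W"
proof -
  note W' = mat_adjoint_carrier[OF W]
  have "W * (mat_adjoint W * A * W) * mat_adjoint W = (W * mat_adjoint W) * A * (W * mat_adjoint W)"
    using A W W' by (simp add: assoc_mult_mat[of _ n n _ n _ n] mult_carrier_mat[of _ n n _ n])
  then show ?thesis using WW A by simp
qed

text \<open>Induction on the dimension: an eigenvector is made the first column of a unitary
  \<open>W\<close>, which splits a 1-by-1 block off \<open>A\<close>, and the remaining block is
  again Hermitian. That the diagonal is real is shown afterwards.\<close>

lemma hermitian_diagonalization_complex: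
  assumes "hermitian_mat n A"
  shows "\<exists>U f. U \<in> carrier_mat n n \<and> mat_adjoint U * U = 1\<^sub>m n \<and>
    A = U * mat_diag n f * mat_adjoint U"
  using assms
proof (induction n arbitrary: A)
  case 0
  then have "A \<in> carrier_mat 0 0" by (simp add: hermitian_mat_def)
  then show ?case
    by (intro exI[of _ "1\<^sub>m 0"] exI[of _ "\<lambda>_. 0"]) auto
next
  case (Suc m)
  let ?n = "Suc m"
  have A: "A \<in> carrier_mat ?n ?n" and Ah: "mat_adjoint A = A"
    using Suc.prems by (auto simp: hermitian_mat_def)
  obtain e where "eigenvalue A e"
    using spectrum_non_empty[OF A] by (auto simp: spectrum_def)
  then obtain v where v: "v \<in> carrier_vec ?n" "v \<noteq> 0\<^sub>v ?n" and Av: "A *\<^sub>v v = e \<cdot>\<^sub>v v"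
    using A by (auto simp: eigenvalue_def eigenvector_def)
  obtain W c where W: "W \<in> carrier_mat ?n ?n" and WW: "mat_adjoint W * W = 1\<^sub>m ?n"
    and W0: "col W 0 = c \<cdot>\<^sub>v v" using unitary_extending_vec[OF v] .
  note W' = mat_adjoint_carrier[OF W]
  have WW': "W * mat_adjoint W = 1\<^sub>m ?n" by (rule mat_mult_left_right_inverse[OF W' W WW])
  define H where "H = mat_adjoint W * A * W"
  have H: "H \<in> carrier_mat ?n ?n" using A W W' by (simp add: H_def mult_carrier_mat[of _ ?n ?n _ ?n])
  have Hh: "mat_adjoint H = H" unfolding H_def by (rule mat_adjoint_hermitian_conj[OF A Ah W])
  \<comment> \<open>The first column of \<open>W\<close> is an eigenvector for \<open>e\<close>, so
    the first column of \<open>H\<close> is \<open>e\<close> times the first column of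
    \<open>mat_adjoint W * W\<close>, which is the identity.\<close>
  have H0: "H $$ (i, 0) = (if i = 0 then e else 0)" if i: "i < ?n" for i
  proof -
    have "col (A * W) 0 = A *\<^sub>v col W 0" using A W by auto
    also have "\<dots> = e \<cdot>\<^sub>v col W 0"
      using A v W0 Av by (simp add: mult_mat_vec[of _ ?n ?n] smult_smult_assoc mult.commute)
    finally have c0: "col (A * W) 0 = e \<cdot>\<^sub>v col W 0" .
    have "H $$ (i, 0) = row (mat_adjoint W) i \<bullet> col (A * W) 0"
      using i A W W' by (simp add: H_def assoc_mult_mat[of _ ?n ?n _ ?n _ ?n] mult_carrier_mat[of _ ?n ?n _ ?n])
    also have "\<dots> = e * (mat_adjoint W * W) $$ (i, 0)"
      using i W W' by (simp add: c0)
    finally show ?thesis using i by (simp add: WW)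
  qed
  \<comment> \<open>As \<open>H\<close> is Hermitian, its first row is the conjugate of its first
    column, so it also vanishes off the diagonal.\<close>
  have H0': "H $$ (0, j) = (if j = 0 then e else 0)" if j: "j < ?n" for j
    using mat_adjoint_index[OF H, of 0 j] mat_adjoint_index[OF H, of 0 0] H0[OF j] H0[of 0] j
    by (auto simp: Hh)
  define K where "K = mat m m (\<lambda>(i, j). H $$ (Suc i, Suc j))"
  have K: "K \<in> carrier_mat m m" by (simp add: K_def)
  have "mat_adjoint K = K"
  proof (rule eq_matI)
    fix i j assume "i < dim_row K" "j < dim_col K"
    then have ij: "i < m" "j < m" using K by auto
    then have "mat_adjoint K $$ (i, j) = conjugate (H $$ (Suc j, Suc i))"
      by (simp add: mat_adjoint_index[OF K]) (simp add: K_def)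
    also have "\<dots> = K $$ (i, j)"
      using ij mat_adjoint_index[OF H, of "Suc i" "Suc j"] by (simp add: Hh K_def)
    finally show "mat_adjoint K $$ (i, j) = K $$ (i, j)" .
  qed (use K mat_adjoint_carrier[OF K] in auto)
  then obtain U f where U: "U \<in> carrier_mat m m" and UU: "mat_adjoint U * U = 1\<^sub>m m"
    and KU: "K = U * mat_diag m f * mat_adjoint U"
    using Suc.IH[of K] K by (auto simp: hermitian_mat_def)
  note U' = mat_adjoint_carrier[OF U]
  \<comment> \<open>\<open>F X Y\<close> is the block diagonal matrix with blocks of sizes 1 and
    \<open>m\<close>. It is multiplicative in both blocks, so the diagonalization of
    \<open>K\<close> extends to \<open>H\<close> by the unitary \<open>P\<close> with blocks 1 and
    \<open>U\<close>.\<close>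
  define F where "F X Y = four_block_mat X (0\<^sub>m 1 m) (0\<^sub>m m 1) Y" for X Y :: "complex mat"
  have Fmult: "F X Y * F X' Y' = F (X * X') (Y * Y')"
    if "X \<in> carrier_mat 1 1" "X' \<in> carrier_mat 1 1" "Y \<in> carrier_mat m m" "Y' \<in> carrier_mat m m"
    for X X' Y Y'
    unfolding F_def using that by (subst mult_four_block_mat[of _ 1 1 _ m _ m _ _ 1 _ m]) auto
  have Fcarr: "F X Y \<in> carrier_mat ?n ?n"
    if "X \<in> carrier_mat 1 1" "Y \<in> carrier_mat m m" for X Y
    using four_block_carrier_mat[OF that] by (simp add: F_def)
  define P where "P = F (1\<^sub>m 1) U"
  have P: "P \<in> carrier_mat ?n ?n" unfolding P_def by (rule Fcarr) (use U in auto)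
  have P': "mat_adjoint P = F (1\<^sub>m 1) (mat_adjoint U)"
  proof (rule eq_matI)
    fix i j assume "i < dim_row (F (1\<^sub>m 1) (mat_adjoint U))" "j < dim_col (F (1\<^sub>m 1) (mat_adjoint U))"
    then show "mat_adjoint P $$ (i, j) = F (1\<^sub>m 1) (mat_adjoint U) $$ (i, j)"
      using U mat_adjoint_index[OF P, of i j]
      by (auto simp: P_def F_def mat_adjoint_index[OF U] not_less)
  qed (use mat_adjoint_carrier[OF P] Fcarr[OF _ U', of "1\<^sub>m 1"] in auto)
  have PP: "mat_adjoint P * P = 1\<^sub>m ?n"
    unfolding P' unfolding P_def using U U' UU
    by (simp add: Fmult) (auto simp: F_def intro!: eq_matI)
  \<comment> \<open>The diagonal of \<open>H\<close> after conjugation: \<open>e\<close> first, then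
    the diagonal of \<open>K\<close>, shifted by one.\<close>
  define g where "g i = (case i of 0 \<Rightarrow> e | Suc j \<Rightarrow> f j)" for i
  let ?E = "mat 1 1 (\<lambda>_. e)"
  have "H = F ?E K"
    by (rule eq_matI) (use H in \<open>auto simp: F_def K_def H0 H0' less_Suc_eq_0_disj\<close>)
  also have "\<dots> = P * F ?E (mat_diag m f) * mat_adjoint P"
    unfolding P' unfolding P_def using U U' KU by (simp add: Fmult)
  also have "F ?E (mat_diag m f) = mat_diag ?n g"
    by (rule eq_matI) (auto simp: F_def mat_diag_def g_def split: nat.splits)
  finally have HP: "H = P * mat_diag ?n g * mat_adjoint P" .
  note P'c = mat_adjoint_carrier[OF P]
  have "A = W * H * mat_adjoint W"
    unfolding H_def by (rule unitary_conj_cancel[OF A W WW'])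
  also have "\<dots> = (W * P) * mat_diag ?n g * mat_adjoint (W * P)"
    unfolding HP using W W' P P'c
    by (simp add: mat_adjoint_mult[of _ ?n ?n _ ?n] assoc_mult_mat[of _ ?n ?n _ ?n _ ?n] mult_carrier_mat[of _ ?n ?n _ ?n])
  finally have *: "A = (W * P) * mat_diag ?n g * mat_adjoint (W * P)" .
  have "mat_adjoint (W * P) * (W * P) = mat_adjoint P * ((mat_adjoint W * W) * P)"
    using W W' P P'c
    by (simp add: mat_adjoint_mult[of _ ?n ?n _ ?n] assoc_mult_mat[of _ ?n ?n _ ?n _ ?n] mult_carrier_mat[of _ ?n ?n _ ?n])
  also have "\<dots> = 1\<^sub>m ?n" using P PP by (simp add: WW)
  finally show ?case using * W P by (intro exI[of _ "W * P"] exI[of _ g]) auto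
qed

section \<open>The orthogonal cubic of a centred finite probability measure\<close>

lemma orthogonal_cubic_nonneg_above_support:
  fixes w x :: "'a \<Rightarrow> real" and m :: "nat \<Rightarrow> real" and M :: real
  assumes fin: "finite I" and w: "\<And>i. i \<in> I \<Longrightarrow> 0 \<le> w i" and M: "\<And>i. i \<in> I \<Longrightarrow> x i \<le> M"
    and m: "\<And>k. m k = (\<Sum>i\<in>I. w i * x i ^ k)" and m0: "m 0 = 1" and m1: "m 1 = 0"
  defines "b1 \<equiv> - m 4 * m 3 - (m 2)^2 * m 3 + m 2 * m 5"
    and "b2 \<equiv> - m 3 * m 5 + (m 4)^2 + (m 3)^2 * m 2 - (m 2)^2 * m 4"
    and "b3 \<equiv> 2 * m 2 * m 3 * m 4 - (m 2)^2 * m 5 - (m 3)^3"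
    and "g \<equiv> (m 3)^2 - m 2 * m 4 + (m 2)^3"
  assumes g: "g \<noteq> 0"
  shows "0 \<le> poly [:b3 / g, b2 / g, b1 / g, 1:] M"
proof (rule ccontr)
  define p where "p = [:b3 / g, b2 / g, b1 / g, 1:]"
  assume "\<not> ?thesis"
  then have neg: "poly p M < 0" by (simp add: p_def)
  obtain N where N: "\<And>y. y \<ge> N \<Longrightarrow> poly p y \<ge> lead_coeff p"
    using poly_pinfty_gt_lc[of p] by (auto simp: p_def)
  \<comment> \<open>The leading coefficient is 1, so \<open>p\<close> is positive beyond
    \<open>N\<close>. Taking the maximum with \<open>M + 1\<close> gives such a point strictly to
    the right of \<open>M\<close>, as the intermediate value theorem requires.\<close>
  have "0 < poly p (max N (M + 1))" using N[of "max N (M + 1)"] by (simp add: p_def)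
  with poly_IVT_pos[of M "max N (M + 1)" p] neg obtain r where r: "M < r" "poly p r = 0"
    by (metis less_add_one less_max_iff_disj)
  define c1 c2 c3 where c: "c1 = b1 / g" "c2 = b2 / g" "c3 = b3 / g"
  \<comment> \<open>Synthetic division: \<open>p = (y - r) q\<close> with \<open>q = y\<^sup>2 + a y + b\<close>.\<close>
  define a b where ab: "a = c1 + r" "b = c2 + r * (c1 + r)"
  have "c3 = - r * b" using r(2) by (simp add: p_def c ab algebra_simps)
  then have c3: "c3 = - r * b" "c2 = b - r * a" "c1 = a - r" by (auto simp: ab)
  \<comment> \<open>Integration of a polynomial of degree at most 5, the degree of
    \<open>(r - y) q\<^sup>2\<close>. The coefficient \<open>\<beta>\<close> drops out because the
    mean \<open>m 1\<close> is zero.\<close>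
  have quad: "(\<Sum>i\<in>I. w i * (\<alpha> + \<beta> * x i + \<delta> * x i ^ 2 + \<epsilon> * x i ^ 3 + \<zeta> * x i ^ 4 + \<eta> * x i ^ 5))
      = \<alpha> + \<delta> * m 2 + \<epsilon> * m 3 + \<zeta> * m 4 + \<eta> * m 5" for \<alpha> \<beta> \<delta> \<epsilon> \<zeta> \<eta>
  proof -
    have "(\<Sum>i\<in>I. w i * (\<alpha> + \<beta> * x i + \<delta> * x i ^ 2 + \<epsilon> * x i ^ 3 + \<zeta> * x i ^ 4 + \<eta> * x i ^ 5))
      = \<alpha> * m 0 + \<beta> * m 1 + \<delta> * m 2 + \<epsilon> * m 3 + \<zeta> * m 4 + \<eta> * m 5"
      unfolding m by (simp add: sum_distrib_left sum.distrib algebra_simps)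
    then show ?thesis using m0 m1 by simp
  qed
  define q where "q y = y^2 + a * y + b" for y
  \<comment> \<open>The coefficients of \<open>p\<close> are the solution by Cramer's rule of the
    three equations stating that \<open>p\<close> is orthogonal to 1, \<open>y\<close> and
    \<open>y\<^sup>2\<close>. Multiplied by \<open>g\<close>, these are polynomial identities in the
    moments; \<open>g\<close> is cancelled afterwards.\<close>
  have orth: "g * c3 + g * c1 * m 2 + g * m 3 = 0" "g * c2 * m 2 + g * c1 * m 3 + g * m 4 = 0"
    "g * c3 * m 2 + g * c2 * m 3 + g * c1 * m 4 + g * m 5 = 0"
    using g by (simp_all add: c) (simp_all add: b1_def b2_def b3_def g_def algebra_simps power2_eq_square power3_eq_cube)
  have orth': "c3 + c1 * m 2 + m 3 = 0" "c2 * m 2 + c1 * m 3 + m 4 = 0"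
    "c3 * m 2 + c2 * m 3 + c1 * m 4 + m 5 = 0"
    using orth g by (simp_all add: distrib_left[symmetric] mult.assoc)
  have "(\<Sum>i\<in>I. w i * ((r - x i) * q (x i) ^ 2)) = (\<Sum>i\<in>I. w i * (r*b^2 + (2*r*a*b - b^2) * x i
      + (r*(a^2+2*b) - 2*a*b) * x i ^ 2 + (2*r*a - a^2 - 2*b) * x i ^ 3 + (r - 2*a) * x i ^ 4 + (-1) * x i ^ 5))"
    by (rule sum.cong) (auto simp: q_def algebra_simps power2_eq_square eval_nat_numeral)
  \<comment> \<open>Since \<open>(r - y) q\<^sup>2 = - p q\<close> and
    \<open>q = y\<^sup>2 + a y + b\<close>, the integral is minus the combination of the three
    orthogonality relations with the coefficients \<open>b\<close>, \<open>a\<close> and 1 of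
    \<open>q\<close>.\<close>
  also have "\<dots> = - (b * (c3 + c1 * m 2 + m 3) + a * (c2 * m 2 + c1 * m 3 + m 4) 
      + (c3 * m 2 + c2 * m 3 + c1 * m 4 + m 5))"
    unfolding quad c3 by (simp add: algebra_simps power2_eq_square)
  also have "\<dots> = 0" unfolding orth' by simp
  finally have "(\<Sum>i\<in>I. w i * ((r - x i) * q (x i) ^ 2)) = 0" .
  moreover have "0 \<le> w i * ((r - x i) * q (x i) ^ 2)" if "i \<in> I" for i
    using w[OF that] M[OF that] r(1) by simp
  ultimately have z: "\<forall>i\<in>I. w i * ((r - x i) * q (x i) ^ 2) = 0"
    using fin by (simp add: sum_nonneg_eq_0_iff)
  have wq: "w i * q (x i) = 0" if "i \<in> I" for i
    using z[rule_format, OF that] M[OF that] r(1) by auto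
  \<comment> \<open>Since \<open>w i * q (x i)\<close> vanishes everywhere, integrating
    \<open>q\<close> against 1, \<open>y\<close> and \<open>y\<^sup>2\<close> gives
    \<open>e0\<close>, \<open>e1\<close> and \<open>e2\<close>: the vector \<open>(b, a, 1)\<close>
    lies in the kernel of the Hankel matrix. The zero coefficients only match the shape of
    \<open>quad\<close>.\<close>
  have "(\<Sum>i\<in>I. w i * (b + a * x i + 1 * x i ^ 2 + 0 * x i ^ 3 + 0 * x i ^ 4 + 0 * x i ^ 5)) = 0"
    using wq by (intro sum.neutral) (auto simp: q_def algebra_simps)
  then have e0: "b + m 2 = 0" unfolding quad by simp
  have "(\<Sum>i\<in>I. w i * (0 + b * x i + a * x i ^ 2 + 1 * x i ^ 3 + 0 * x i ^ 4 + 0 * x i ^ 5)) =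
      (\<Sum>i\<in>I. w i * q (x i) * x i)"
    by (intro sum.cong) (auto simp: q_def algebra_simps eval_nat_numeral)
  then have e1: "a * m 2 + m 3 = 0" unfolding quad by (simp add: wq)
  have "(\<Sum>i\<in>I. w i * (0 + 0 * x i + b * x i ^ 2 + a * x i ^ 3 + 1 * x i ^ 4 + 0 * x i ^ 5)) =
      (\<Sum>i\<in>I. w i * q (x i) * x i ^ 2)"
    by (intro sum.cong) (auto simp: q_def algebra_simps eval_nat_numeral)
  then have e2: "b * m 2 + a * m 3 + m 4 = 0" unfolding quad by (simp add: wq)
  \<comment> \<open>Singularity of the Hankel matrix made explicit: \<open>g\<close> is a
    combination of the left sides of \<open>e0\<close>, \<open>e1\<close> and
    \<open>e2\<close>.\<close>
  have "g = (m 3)\<^sup>2 + (a * m 2) * m 3 - m 2 * (b * m 2 + a * m 3 + m 4) + (m 2)^2 * (b + m 2)"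
    by (simp add: g_def algebra_simps power2_eq_square power3_eq_cube)
  also have "\<dots> = m 3 * (a * m 2 + m 3)" unfolding e0 e2 by (simp add: algebra_simps power2_eq_square)
  finally show False using g e1 by simp
qed

text \<open>Under the reflection of \<open>x\<close> to \<open>- x\<close> the moment
  \<open>m k\<close> acquires the factor \<open>(-1) ^ k\<close>. By total degree, \<open>g\<close>
  and \<open>b2\<close> are unchanged while \<open>b1\<close> and \<open>b3\<close> change sign, so
  the cubic \<open>p y\<close> becomes \<open>- p (- y)\<close> and the bound above the support
  applies at \<open>- M\<close>.\<close>

lemma orthogonal_cubic_nonpos_below_support:
  fixes w x :: "'a \<Rightarrow> real" and m :: "nat \<Rightarrow> real" and M :: real
  assumes fin: "finite I" and w: "\<And>i. i \<in> I \<Longrightarrow> 0 \<le> w i" and M: "\<And>i. i \<in> I \<Longrightarrow> M \<le> x i"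
    and m: "\<And>k. m k = (\<Sum>i\<in>I. w i * x i ^ k)" and m0: "m 0 = 1" and m1: "m 1 = 0"
  defines "b1 \<equiv> - m 4 * m 3 - (m 2)^2 * m 3 + m 2 * m 5"
    and "b2 \<equiv> - m 3 * m 5 + (m 4)^2 + (m 3)^2 * m 2 - (m 2)^2 * m 4"
    and "b3 \<equiv> 2 * m 2 * m 3 * m 4 - (m 2)^2 * m 5 - (m 3)^3"
    and "g \<equiv> (m 3)^2 - m 2 * m 4 + (m 2)^3"
  assumes g: "g \<noteq> 0"
  shows "poly [:b3 / g, b2 / g, b1 / g, 1:] M \<le> 0"
proof -
  have m': "(-1) ^ k * m k = (\<Sum>i\<in>I. w i * (- x i) ^ k)" for k
    unfolding m sum_distrib_left by (rule sum.cong) (auto simp: power_minus[of "x _"])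
  have "0 \<le> poly [:(- b3) / g, b2 / g, (- b1) / g, 1:] (- M)"
    using orthogonal_cubic_nonneg_above_support[of I w "\<lambda>i. - x i" "- M" "\<lambda>k. (-1) ^ k * m k"]
      fin w M m' m0 m1 g
    by (simp add: b1_def b2_def b3_def g_def power_mult_distrib algebra_simps del: poly_pCons)
  also have "\<dots> = - poly [:b3 / g, b2 / g, b1 / g, 1:] M"
    by (simp add: algebra_simps)
  finally show ?thesis by simp
qed

section \<open>Conjugated diagonal matrices and positive functionals on them\<close>

lemma similar_diag_eigenvalue:
  fixes U :: "'a :: field mat"
  assumes "U \<in> carrier_mat n n" "V \<in> carrier_mat n n" "V * U = 1\<^sub>m n" "U * V = 1\<^sub>m n" and i: "i < n"
  shows "eigenvalue (U * mat_diag n f * V) (f i)"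
proof -
  let ?B = "U * mat_diag n f * V"
  have B: "?B \<in> carrier_mat n n" using assms by (simp add: mult_carrier_mat[of _ n n _ n])
  have "similar_mat_wit ?B (mat_diag n f) U V"
    by (rule similar_mat_witI[of _ _ n]) (use assms B in auto)
  then have "char_poly ?B = char_poly (mat_diag n f)"
    by (intro char_poly_similar) (auto simp: similar_mat_def)
  also have "\<dots> = (\<Prod>a\<leftarrow>diag_mat (mat_diag n f). [:- a, 1:])"
    by (rule char_poly_upper_triangular[OF mat_diag_dim]) (auto simp: mat_diag_def)
  finally have "poly (char_poly ?B) (f i) = (\<Prod>a\<leftarrow>diag_mat (mat_diag n f). f i - a)"
    by (simp add: poly_prod_list o_def)
  moreover have "f i \<in> set (diag_mat (mat_diag n f))"
    using i by (auto simp: diag_mat_def mat_diag_def)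
  ultimately show ?thesis
    unfolding eigenvalue_root_char_poly[OF B] by (auto simp: prod_list_zero_iff)
qed

lemma mat_adjoint_mat_diag:
  fixes f :: "nat \<Rightarrow> 'a :: conjugatable_field"
  shows "mat_adjoint (mat_diag n f) = mat_diag n (\<lambda>i. conjugate (f i))"
proof (rule eq_matI)
  fix i j assume "i < dim_row (mat_diag n (\<lambda>i. conjugate (f i)))"
    "j < dim_col (mat_diag n (\<lambda>i. conjugate (f i)))"
  then have "i < n" "j < n" by (auto simp: mat_diag_def)
  then show "mat_adjoint (mat_diag n f) $$ (i, j) = mat_diag n (\<lambda>i. conjugate (f i)) $$ (i, j)"
    by (simp add: mat_adjoint_index[OF mat_diag_dim]) (auto simp: mat_diag_def)
qed (auto simp: mat_diag_def)

text \<open>The diagonal factor equals \<open>mat_adjoint U * A * U\<close>, which inherits being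
  Hermitian from \<open>A\<close>; a diagonal matrix equal to its adjoint has real entries.\<close>

lemma hermitian_diagonalization:
  assumes "hermitian_mat n A"
  obtains U d where "U \<in> carrier_mat n n" "mat_adjoint U * U = 1\<^sub>m n" "U * mat_adjoint U = 1\<^sub>m n"
    "A = U * mat_diag n (\<lambda>i. complex_of_real (d i)) * mat_adjoint U"
proof -
  have A: "A \<in> carrier_mat n n" "mat_adjoint A = A" using assms by (auto simp: hermitian_mat_def)
  obtain U f where U: "U \<in> carrier_mat n n" and UU: "mat_adjoint U * U = 1\<^sub>m n"
    and Af: "A = U * mat_diag n f * mat_adjoint U"
    using hermitian_diagonalization_complex[OF assms] by blast
  note U' = mat_adjoint_carrier[OF U]
  have UU': "U * mat_adjoint U = 1\<^sub>m n" by (rule mat_mult_left_right_inverse[OF U' U UU])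
  have "mat_diag n f = (mat_adjoint U * U) * mat_diag n f * (mat_adjoint U * U)"
    by (simp add: UU left_mult_one_mat[OF mat_diag_dim] right_mult_one_mat[OF mat_diag_dim])
  also have "\<dots> = mat_adjoint U * A * U"
    unfolding Af using U U'
    by (simp add: assoc_mult_mat[of _ n n _ n _ n] mult_carrier_mat[of _ n n _ n])
  finally have D: "mat_adjoint (mat_diag n f) = mat_diag n f"
    using mat_adjoint_hermitian_conj[OF A U] by simp
  have "f i = complex_of_real (Re (f i))" if "i < n" for i
    using arg_cong[OF D, of "\<lambda>M. M $$ (i, i)"] that
    unfolding mat_adjoint_mat_diag by (simp add: mat_diag_def complex_eq_iff)
  then have "mat_diag n f = mat_diag n (\<lambda>i. complex_of_real (Re (f i)))"
    by (intro eq_matI) (auto simp: mat_diag_def)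
  then show ?thesis using that[OF U UU UU'] Af by metis
qed

lemma conj_diag_add:
  fixes U V :: "'a :: semiring_0 mat"
  assumes "U \<in> carrier_mat n n" "V \<in> carrier_mat n n"
  shows "U * mat_diag n (\<lambda>i. f i + g i) * V = U * mat_diag n f * V + U * mat_diag n g * V"
proof -
  have "mat_diag n (\<lambda>i. f i + g i) = mat_diag n f + mat_diag n g"
    by (intro eq_matI) (auto simp: mat_diag_def)
  then show ?thesis using assms
    by (simp add: mult_add_distrib_mat[of _ n n _ n] add_mult_distrib_mat[of _ n n _ _ n]
        mult_carrier_mat[of _ n n _ n])
qed

lemma conj_diag_smult:
  fixes U V :: "'a :: comm_semiring_0 mat"
  assumes "U \<in> carrier_mat n n" "V \<in> carrier_mat n n"
  shows "U * mat_diag n (\<lambda>i. c * f i) * V = c \<cdot>\<^sub>m (U * mat_diag n f * V)"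
proof -
  have "mat_diag n (\<lambda>i. c * f i) = c \<cdot>\<^sub>m mat_diag n f"
    by (intro eq_matI) (auto simp: mat_diag_def)
  then show ?thesis using assms
    by (simp add: mult_smult_distrib[of _ n n _ n] mult_smult_assoc_mat[of _ n n _ n]
        mult_carrier_mat[of _ n n _ n])
qed

lemma conj_diag_pow:
  fixes U V :: "'a :: comm_semiring_1 mat"
  assumes U: "U \<in> carrier_mat n n" and V: "V \<in> carrier_mat n n"
    and VU: "V * U = 1\<^sub>m n" and UV: "U * V = 1\<^sub>m n"
  shows "(U * mat_diag n f * V) ^\<^sub>m k = U * mat_diag n (\<lambda>i. f i ^ k) * V"
proof (induction k)
  case 0
  then show ?case using U V UV by simp
next
  case (Suc k)
  \<comment> \<open>Regrouped so that the inner \<open>V * U\<close> cancels and the two diagonal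
    factors meet.\<close>
  have "(U * mat_diag n f * V) ^\<^sub>m Suc k
      = U * mat_diag n (\<lambda>i. f i ^ k) * (V * U) * (mat_diag n f * V)"
    unfolding pow_mat.simps Suc.IH using U V
    by (simp add: assoc_mult_mat[of _ n n _ n _ n] mult_carrier_mat[of _ n n _ n] del: mat_diag_diag)
  also have "\<dots> = U * (mat_diag n (\<lambda>i. f i ^ k) * mat_diag n f) * V"
    using U V by (simp add: VU right_mult_one_mat[of _ n n] assoc_mult_mat[of _ n n _ n _ n]
        mult_carrier_mat[of _ n n _ n] del: mat_diag_diag)
  finally show ?case by (simp add: mult.commute)
qed

text \<open>On the matrices diagonalized by a fixed \<open>U\<close>, the functional is integration
  against a finite measure on \<open>n\<close> points. The weight \<open>w i\<close> is the value of
  \<open>\<phi>\<close> at the projection onto column \<open>i\<close> of \<open>U\<close>.\<close>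

lemma positive_functional_conj_diag:
  assumes lin: "linear_functional_mat n \<phi>" and pos: "positive_functional_mat n \<phi>"
    and U: "U \<in> carrier_mat n n"
  obtains w where "\<And>i. 0 \<le> w i"
    "\<And>f. \<phi> (U * mat_diag n f * mat_adjoint U) = (\<Sum>i<n. f i * complex_of_real (w i))"
proof -
  note U' = mat_adjoint_carrier[OF U]
  define S where "S f = U * mat_diag n f * mat_adjoint U" for f
  have S: "S f \<in> carrier_mat n n" for f
    unfolding S_def using U U' by (simp add: mult_carrier_mat[of _ n n _ n])
  have "S (\<lambda>i. f i + g i) = S f + S g" for f g
    unfolding S_def by (rule conj_diag_add[OF U U'])
  then have add: "\<phi> (S (\<lambda>i. f i + g i)) = \<phi> (S f) + \<phi> (S g)" for f g
    using lin S[of f] S[of g] unfolding linear_functional_mat_def by metis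
  have "S (\<lambda>i. c * f i) = c \<cdot>\<^sub>m S f" for c f
    unfolding S_def by (rule conj_diag_smult[OF U U'])
  then have smult: "\<phi> (S (\<lambda>i. c * f i)) = c * \<phi> (S f)" for c f
    using lin S[of f] unfolding linear_functional_mat_def by metis
  define e where "e i = (\<lambda>k. if k = i then 1 else 0 :: complex)" for i :: nat
  \<comment> \<open>The diagonal unit \<open>?E\<close> is a self-adjoint idempotent, so
    \<open>S (e i)\<close> is \<open>mat_adjoint ?X * ?X\<close>.\<close>
  have e_nonneg: "0 \<le> \<phi> (S (e i))" for i
  proof -
    let ?E = "mat_diag n (e i)"
    let ?X = "?E * mat_adjoint U"
    have cnj_e: "(\<lambda>k. cnj (e i k)) = e i" and ee: "(\<lambda>k. e i k * e i k) = e i"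
      by (auto simp: e_def)
    have X: "?X \<in> carrier_mat n n" using U' by (intro mult_carrier_mat[of _ n n]) auto
    have "mat_adjoint ?X * ?X = U * (?E * ?E) * mat_adjoint U"
      using U U'
      by (simp add: mat_adjoint_mult[of _ n n _ n] mat_adjoint_mat_diag cnj_e
          assoc_mult_mat[of _ n n _ n _ n] mult_carrier_mat[of _ n n _ n] del: mat_diag_diag)
    then have "mat_adjoint ?X * ?X = S (e i)" by (simp add: S_def ee)
    then show ?thesis
      using psd_mat_adjoint_mult[OF X] pos unfolding positive_functional_mat_def by simp
  qed
  \<comment> \<open>Linearity is available for two summands only, so \<open>f\<close> is built up
    one index at a time; \<open>restrict\<close> then identifies the truncation at \<open>n\<close>
    with \<open>f\<close> itself.\<close>
  have partial: "\<phi> (S (\<lambda>i. if i < m then f i else 0)) = (\<Sum>i<m. f i * \<phi> (S (e i)))" for f m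
  proof (induction m)
    case 0
    show ?case using smult[of 0 "\<lambda>_. 0"] by simp
  next
    case (Suc m)
    have "(\<lambda>i. if i < Suc m then f i else 0) = (\<lambda>i. (if i < m then f i else 0) + f m * e m i)"
      by (auto simp: e_def less_Suc_eq)
    then show ?case using Suc.IH by (simp add: add smult)
  qed
  have restrict: "S f = S (\<lambda>i. if i < n then f i else 0)" for f
  proof -
    have "mat_diag n f = mat_diag n (\<lambda>i. if i < n then f i else 0)"
      by (intro eq_matI) (auto simp: mat_diag_def)
    then show ?thesis by (simp add: S_def)
  qed
  define w where "w i = Re (\<phi> (S (e i)))" for i
  have w: "complex_of_real (w i) = \<phi> (S (e i))" for i
    using e_nonneg[of i] by (simp add: w_def complex_eq_iff less_eq_complex_def)
  show ?thesis
  proof (rule that[of w])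
    show "0 \<le> w i" for i
      using e_nonneg[of i] by (simp add: w_def less_eq_complex_def)
    show "\<phi> (U * mat_diag n f * mat_adjoint U) = (\<Sum>i<n. f i * complex_of_real (w i))" for f
      unfolding w S_def[symmetric] by (subst restrict, rule partial)
  qed
qed

section \<open>From the functional to the moments of the eigenvalues\<close>

lemma poly_of_real_cubic:
  "poly [:complex_of_real a, complex_of_real b, complex_of_real c, 1:] (complex_of_real x)
    = complex_of_real (poly [:a, b, c, 1:] x)"
  by simp

theorem theorem3p3:
  fixes n :: nat and \<phi> :: "complex mat \<Rightarrow> complex" and A B :: "complex mat"
    and \<beta>\<^sub>1 \<beta>\<^sub>2 \<beta>\<^sub>3 \<gamma> :: complex and p :: "complex poly"
  assumes "linear_functional_mat n \<phi>"
    and "positive_functional_mat n \<phi>"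
    and "unital_functional_mat n \<phi>"
    and "hermitian_mat n A"
  defines "B \<equiv> A - \<phi> A \<cdot>\<^sub>m 1\<^sub>m n"
  defines "\<beta>\<^sub>1 \<equiv> - \<phi> (B ^\<^sub>m 4) * \<phi> (B ^\<^sub>m 3) - (\<phi> (B ^\<^sub>m 2))^2 * \<phi> (B ^\<^sub>m 3)
                 + \<phi> (B ^\<^sub>m 2) * \<phi> (B ^\<^sub>m 5)"
    and "\<beta>\<^sub>2 \<equiv> - \<phi> (B ^\<^sub>m 3) * \<phi> (B ^\<^sub>m 5) + (\<phi> (B ^\<^sub>m 4))^2
                 + (\<phi> (B ^\<^sub>m 3))^2 * \<phi> (B ^\<^sub>m 2) - (\<phi> (B ^\<^sub>m 2))^2 * \<phi> (B ^\<^sub>m 4)"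
    and "\<beta>\<^sub>3 \<equiv> 2 * \<phi> (B ^\<^sub>m 2) * \<phi> (B ^\<^sub>m 3) * \<phi> (B ^\<^sub>m 4)
                 - (\<phi> (B ^\<^sub>m 2))^2 * \<phi> (B ^\<^sub>m 5) - (\<phi> (B ^\<^sub>m 3))^3"
    and "\<gamma> \<equiv> (\<phi> (B ^\<^sub>m 3))^2 - \<phi> (B ^\<^sub>m 2) * \<phi> (B ^\<^sub>m 4) + (\<phi> (B ^\<^sub>m 2))^3"
  assumes "\<gamma> \<noteq> 0"
  defines "p \<equiv> [:\<beta>\<^sub>3 / \<gamma>, \<beta>\<^sub>2 / \<gamma>, \<beta>\<^sub>1 / \<gamma>, 1:]"
  shows "poly p (complex_of_real (max_eigenvalue B)) \<ge> 0 \<and>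
         poly p (complex_of_real (min_eigenvalue B)) \<le> 0"
proof -
  obtain U d where U: "U \<in> carrier_mat n n" and UU: "mat_adjoint U * U = 1\<^sub>m n"
    and UU': "U * mat_adjoint U = 1\<^sub>m n"
    and A: "A = U * mat_diag n (\<lambda>i. complex_of_real (d i)) * mat_adjoint U"
    using hermitian_diagonalization[OF assms(4)] .
  note U' = mat_adjoint_carrier[OF U]
  obtain w where w: "\<And>i. 0 \<le> w i"
    and \<phi>: "\<And>f. \<phi> (U * mat_diag n f * mat_adjoint U) = (\<Sum>i<n. f i * complex_of_real (w i))"
    using positive_functional_conj_diag[OF assms(1,2) U] by blast
  \<comment> \<open>\<open>c\<close> is the mean of the eigenvalues \<open>d i\<close> of
    \<open>A\<close>, and the \<open>x i\<close> defined from it are the centred values, which are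
    eigenvalues of \<open>B\<close>.\<close>
  define c where "c = (\<Sum>i<n. d i * w i)"
  have \<phi>A: "\<phi> A = complex_of_real c" unfolding A \<phi> c_def by simp
  define x where "x i = d i - c" for i
  have I: "U * mat_diag n (\<lambda>_. 1) * mat_adjoint U = 1\<^sub>m n" using U UU' by simp
  have A_eq: "A = U * mat_diag n (\<lambda>i. complex_of_real (x i)) * mat_adjoint U
      + complex_of_real c \<cdot>\<^sub>m 1\<^sub>m n"
    by (subst I[symmetric], subst conj_diag_smult[OF U U', symmetric],
        subst conj_diag_add[OF U U', symmetric]) (simp add: A x_def)
  have Bc: "U * mat_diag n (\<lambda>i. complex_of_real (x i)) * mat_adjoint U \<in> carrier_mat n n"
    using U U' by (simp add: mult_carrier_mat[of _ n n _ n])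
  have B: "B = U * mat_diag n (\<lambda>i. complex_of_real (x i)) * mat_adjoint U"
    unfolding B_def \<phi>A by (subst A_eq, rule eq_matI) (use Bc in auto)
  have B_carrier: "B \<in> carrier_mat n n" using Bc B by simp
  define m where "m k = (\<Sum>i<n. w i * x i ^ k)" for k
  have \<phi>B: "\<phi> (B ^\<^sub>m k) = complex_of_real (m k)" for k
    unfolding B conj_diag_pow[OF U U' UU UU'] \<phi> m_def by (simp add: mult.commute)
  \<comment> \<open>The zeroth power is the identity, so unitality says that the weights sum to 1.
    In particular \<open>n\<close> is positive.\<close>
  have "complex_of_real (m 0) = \<phi> (1\<^sub>m n)" using \<phi>B[of 0] B_carrier by simp
  then have m0: "m 0 = 1" using assms(3) by (simp add: unital_functional_mat_def)
  have "m 1 = (\<Sum>i<n. d i * w i) - c * m 0"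
    by (simp add: m_def x_def algebra_simps sum_subtractf sum_distrib_left)
  then have m1: "m 1 = 0" by (simp add: m0 c_def)
  \<comment> \<open>\<open>Max\<close> and \<open>Min\<close> bound the elements of a set only if it
    is finite. The cubic lemmas ask just for bounds on the points, so it is enough that each
    \<open>x i\<close> is an eigenvalue.\<close>
  have "finite (spectrum B)" by (rule card_finite_spectrum[OF B_carrier])
  moreover have "{y. eigenvalue B (complex_of_real y)} = complex_of_real -` spectrum B"
    by (auto simp: spectrum_def)
  ultimately have fin: "finite {y. eigenvalue B (complex_of_real y)}"
    by (simp add: finite_vimageI inj_of_real)
  have ev: "x i \<in> {y. eigenvalue B (complex_of_real y)}" if "i < n" for i
    using similar_diag_eigenvalue[OF U U' UU UU' that] by (simp add: B)
  have up: "x i \<le> max_eigenvalue B" and low: "min_eigenvalue B \<le> x i" if "i \<in> {..<n}" for i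
    unfolding max_eigenvalue_def min_eigenvalue_def using fin ev that by auto
  let ?g = "(m 3)^2 - m 2 * m 4 + (m 2)^3"
  let ?b1 = "- m 4 * m 3 - (m 2)^2 * m 3 + m 2 * m 5"
  let ?b2 = "- m 3 * m 5 + (m 4)^2 + (m 3)^2 * m 2 - (m 2)^2 * m 4"
  let ?b3 = "2 * m 2 * m 3 * m 4 - (m 2)^2 * m 5 - (m 3)^3"
  let ?p = "[:?b3 / ?g, ?b2 / ?g, ?b1 / ?g, 1:]"
  \<comment> \<open>All moments are real, so \<open>\<gamma>\<close> and the coefficients are real
    too, and both inequalities can be proved over the reals and carried back.\<close>
  have \<gamma>: "\<gamma> = complex_of_real ?g" unfolding \<gamma>_def \<phi>B by simp
  then have g: "?g \<noteq> 0" using assms(10) by (metis of_real_0)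
  have p: "poly p (complex_of_real y) = complex_of_real (poly ?p y)" for y
  proof -
    have "p = [:complex_of_real (?b3 / ?g), complex_of_real (?b2 / ?g), complex_of_real (?b1 / ?g), 1:]"
      unfolding p_def \<gamma> of_real_divide
      unfolding \<beta>\<^sub>1_def \<beta>\<^sub>2_def \<beta>\<^sub>3_def \<phi>B by simp
    then show ?thesis by (simp only: poly_of_real_cubic)
  qed
  have "0 \<le> poly ?p (max_eigenvalue B)"
    by (rule orthogonal_cubic_nonneg_above_support[where I = "{..<n}" and w = w and x = x, OF finite_lessThan w up m_def m0 m1 g])
  moreover have "poly ?p (min_eigenvalue B) \<le> 0"
    by (rule orthogonal_cubic_nonpos_below_support[where I = "{..<n}" and w = w and x = x, OF finite_lessThan w low m_def m0 m1 g])
  moreover have "0 \<le> complex_of_real r" if "0 \<le> r" for r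
    using that by (simp add: less_eq_complex_def)
  moreover have "complex_of_real r \<le> 0" if "r \<le> 0" for r
    using that by (simp add: less_eq_complex_def)
  ultimately show ?thesis
    unfolding p by blast
qed

end
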